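(* For every integer $n\ge0$, $$P_{001}(n)=\sum_{j,k\ge0}q^{j^2+k^2+j}{2n-k-1\brack j}_{q^2}{j+1\brack k}_{q^2}.$$
   Context: For partitions $\lambda=(\lambda_1,\lambda_2,\dots)$, $\mu=(\mu_1,\mu_2,\dots)$ (weakly decreasing, padded by zeros) write $\lambda\succeq\mu$ if $\lambda_1\ge\mu_1\ge\lambda_2\ge\mu_2\ge\cdots$ and $\lambda\preceq\mu$ if $\mu_1\ge\lambda_1\ge\mu_2\ge\lambda_2\ge\cdots$. A skew double shifted plane partition (DSPP) with profile $\delta=\delta_1\delta_2\delta_3\in\{0,1\}^3$ is a 4-tuple of integer partitions $(\lambda^0,\lambda^1,\lambda^2,\lambda^3)$ with $\lambda^{j-1}\succeq\lambda^j$ if $\delta_j=0$ and $\lambda^{j-1}\preceq\lambda^j$ if $\delta_j=1$ ($j=1,2,3$). Its size $|\Lambda|$ is the sum of all parts of the four partitions; its diagonal length is the maximum of the numbers of (positive) parts of the four partitions. Let $\mathrm{DSPP}_{001}(n)$ be the set of DSPPs with profile $001$ and diagonal length at most $n$, $F_{001}(n)=\sum_{\Lambda\in\mathrm{DSPP}_{001}(n)}q^{|\Lambda|}$, and $P_{001}(n)=(q;q)_{4n}F_{001}(n)$. Here $(a;q)_0=1$, $(a;q)_n=\prod_{i=0}^{n-1}(1-aq^i)$ for $n\ge1$, and ${n\brack m}_q=\frac{(q;q)_n}{(q;q)_m(q;q)_{n-m}}$ if $n\ge m\ge0$ and $0$ otherwise; ${n\brack m}_{q^2}$ is the same with $q\to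 q^2$.
   Formalization: The identity is proved for every integer n ≥ 1; the case n = 0 is excluded because there P_001(0) = 1, while every summand on the right vanishes under the stated convention for the q-binomial coefficients. *)

theory Defs
  imports "HOL-Analysis.Infinite_Sum" "HOL-Computational_Algebra.Formal_Power_Series"
begin

(* A partition padded by zeros is a function on nat; lam i stands for the part
   with index i + 1. *)
definition is_partition :: "(nat \<Rightarrow> nat) \<Rightarrow> bool" where
  "is_partition lam \<longleftrightarrow> antimono lam \<and> finite {i. lam i \<noteq> 0}"

definition part_size :: "(nat \<Rightarrow> nat) \<Rightarrow> nat" where
  "part_size lam = (\<Sum>i\<in>{i. lam i \<noteq> 0}. lam i)"

definition part_length :: "(nat \<Rightarrow> nat) \<Rightarrow> nat" where
  "part_length lam = card {i. lam i \<noteq> 0}"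

definition interlace_down :: "(nat \<Rightarrow> nat) \<Rightarrow> (nat \<Rightarrow> nat) \<Rightarrow> bool" where
  "interlace_down lam mu \<longleftrightarrow> (\<forall>i. lam i \<ge> mu i \<and> mu i \<ge> lam (Suc i))"

definition interlace_up :: "(nat \<Rightarrow> nat) \<Rightarrow> (nat \<Rightarrow> nat) \<Rightarrow> bool" where
  "interlace_up lam mu \<longleftrightarrow> (\<forall>i. mu i \<ge> lam i \<and> lam i \<ge> mu (Suc i))"

definition profile_step :: "nat \<Rightarrow> (nat \<Rightarrow> nat) \<Rightarrow> (nat \<Rightarrow> nat) \<Rightarrow> bool" where
  "profile_step d lam mu \<longleftrightarrow>
     (d = 0 \<and> interlace_down lam mu) \<or> (d = 1 \<and> interlace_up lam mu)"

type_synonym dspp = "(nat \<Rightarrow> nat) \<times> (nat \<Rightarrow> nat) \<times> (nat \<Rightarrow> nat) \<times> (nat \<Rightarrow> nat)"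

definition is_dspp :: "nat \<times> nat \<times> nat \<Rightarrow> dspp \<Rightarrow> bool" where
  "is_dspp = (\<lambda>(d1, d2, d3) (l0, l1, l2, l3).
     is_partition l0 \<and> is_partition l1 \<and> is_partition l2 \<and> is_partition l3 \<and>
     profile_step d1 l0 l1 \<and> profile_step d2 l1 l2 \<and> profile_step d3 l2 l3)"

definition dspp_size :: "dspp \<Rightarrow> nat" where
  "dspp_size = (\<lambda>(l0, l1, l2, l3).
     part_size l0 + part_size l1 + part_size l2 + part_size l3)"

definition dspp_diag_length :: "dspp \<Rightarrow> nat" where
  "dspp_diag_length = (\<lambda>(l0, l1, l2, l3).
     Max {part_length l0, part_length l1, part_length l2, part_length l3})"

definition DSPP001 :: "nat \<Rightarrow> dspp set" where
  "DSPP001 n = {L. is_dspp (0, 0, 1) L \<and> dspp_diag_length L \<le> n}"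

definition qpoch :: "'a::comm_ring_1 \<Rightarrow> 'a \<Rightarrow> nat \<Rightarrow> 'a" where
  "qpoch a q n = (\<Prod>i<n. 1 - a * q ^ i)"

(* The base q may be replaced by q^2. The arguments are integers because the upper one
   can be negative, in which case the value is 0. For a base with zero constant term
   the denominator is a unit, so the division of power series is exact. *)
definition qbinom :: "rat fps \<Rightarrow> int \<Rightarrow> int \<Rightarrow> rat fps" where
  "qbinom q n m =
     (if n \<ge> m \<and> m \<ge> 0
      then qpoch q q (nat n) / (qpoch q q (nat m) * qpoch q q (nat (n - m)))
      else 0)"

lemma finite_partitions_size_le: "finite {lam. is_partition lam \<and> part_size lam \<le> m}"
proof (rule finite_subset)
  let ?B = "{f. \<forall>i. (i \<in> {..<m} \<longrightarrow> f i \<in> {..m}) \<and> (i \<notin> {..<m} \<longrightarrow> f i = (0::nat))}"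
  show "finite ?B" by (rule finite_set_of_finite_funs) auto
  show "{lam. is_partition lam \<and> part_size lam \<le> m} \<subseteq> ?B"
  proof clarify
    fix lam :: "nat \<Rightarrow> nat" and i
    assume p: "is_partition lam" and s: "part_size lam \<le> m"
    let ?S = "{i. lam i \<noteq> 0}"
    have fin: "finite ?S" and anti: "antimono lam" using p by (auto simp: is_partition_def)
    have le: "lam i \<le> m"
    proof (cases "i \<in> ?S")
      case True
      then have "lam i \<le> part_size lam"
        unfolding part_size_def by (intro member_le_sum fin) auto
      then show ?thesis using s by simp
    qed auto
    have zero: "lam i = 0" if "i \<ge> m"
    proof (rule ccontr)
      assume nz: "lam i \<noteq> 0"
      have sub: "{..i} \<subseteq> ?S"
      proof
        fix k assume "k \<in> {..i}"
        then have "lam i \<le> lam k" using anti by (auto simp: antimono_def)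
        then show "k \<in> ?S" using nz by auto
      qed
      have "Suc i \<le> card ?S" using card_mono[OF fin sub] by simp
      also have "card ?S = (\<Sum>i\<in>?S. 1)" by simp
      also have "\<dots> \<le> part_size lam" unfolding part_size_def by (rule sum_mono) auto
      finally show False using s that by simp
    qed
    show "(i \<in> {..<m} \<longrightarrow> lam i \<in> {..m}) \<and> (i \<notin> {..<m} \<longrightarrow> lam i = 0)"
      using le zero by auto
  qed
qed

(* Hence the cardinalities in F001 are those of finite sets. *)
lemma finite_DSPP001_size: "finite {L \<in> DSPP001 n. dspp_size L = m}"
proof (rule finite_subset)
  let ?A = "{lam. is_partition lam \<and> part_size lam \<le> m}"
  show "finite (?A \<times> ?A \<times> ?A \<times> ?A)"
    by (intro finite_cartesian_product finite_partitions_size_le)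
  show "{L \<in> DSPP001 n. dspp_size L = m} \<subseteq> ?A \<times> ?A \<times> ?A \<times> ?A"
    by (auto simp: DSPP001_def is_dspp_def dspp_size_def)
qed

(* The coefficient of q^m in the sum of q^|L| over L is the number of L of size m. *)
definition F001 :: "nat \<Rightarrow> rat fps" where
  "F001 n = Abs_fps (\<lambda>m. of_nat (card {L \<in> DSPP001 n. dspp_size L = m}))"

definition P001 :: "nat \<Rightarrow> rat fps" where
  "P001 n = qpoch fps_X fps_X (4 * n) * F001 n"

end

theory Submission
  imports Defs
begin

text \<open>
  Write \<open>a, b, c, d\<close> for the four partitions of a double shifted plane partition with profile 001.
  The interlacing conditions say that \<open>b\<close> lies below \<open>a\<close>, and \<open>c\<close> below both \<open>b\<close> and \<open>d\<close>.
  Read along the single sequence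
  \<open>a\<^sub>0, b\<^sub>0, d\<^sub>0, c\<^sub>0, a\<^sub>1, b\<^sub>1, d\<^sub>1, c\<^sub>1, \<dots>\<close>
  they become one uniform pattern: an entry at an even position \<open>i\<close> dominates the one at \<open>i + 1\<close>,
  an entry at an odd position \<open>i\<close> dominates those at \<open>i + 2\<close> and \<open>i + 3\<close>. So \<open>F\<^sub>0\<^sub>0\<^sub>1(n)\<close> is the
  generating function of the P-partitions of the first \<open>4n\<close> positions of this strip
  (\<open>P001_eq_strip_num\<close>).

  Let \<open>p N = (q; q)\<^sub>N\<close> times the generating function for the first \<open>N\<close> positions. Subtracting 1 from all
  values until a minimal element becomes 0, and inclusion-exclusion over the minimal elements with
  value 0, gives a recursion that removes minimal elements
  (\<open>ppart_numerator_one_min\<close>, \<open>ppart_numerator_two_min\<close>). The first \<open>2m\<close> positions have a single minimal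
  element and the first \<open>2m + 1\<close> two of them, for \<open>m \<ge> 1\<close>. With \<open>x\<^sub>m = p (2m + 1)\<close>
  the recursion collapses to
  \<open>x\<^sub>m = (1 + q\<^sup>2\<^sup>m) x\<^sub>m\<^sub>-\<^sub>1 + q\<^sup>2\<^sup>m\<^sup>-\<^sup>1 x\<^sub>m\<^sub>-\<^sub>2\<close> for \<open>m \<ge> 2\<close>, and \<open>P\<^sub>0\<^sub>0\<^sub>1(n) = p (4n) = p (4n - 1) = x\<^sub>2\<^sub>n\<^sub>-\<^sub>1\<close>.

  The double sum \<open>S\<^sub>m\<close> with \<open>2n - 1\<close> replaced by \<open>m\<close> obeys the same recurrence for \<open>m \<ge> 2\<close>. One q-Pascal rule
  turns \<open>S\<^sub>m - S\<^sub>m\<^sub>-\<^sub>1\<close> into a sum with \<open>j\<close> shifted by one; the other q-Pascal rule, applied to the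
  second binomial, splits that into a copy of \<open>q\<^sup>2\<^sup>m S\<^sub>m\<^sub>-\<^sub>1\<close> and, after shifting \<open>k\<close> by one, a copy of
  \<open>q\<^sup>2\<^sup>m\<^sup>-\<^sup>1 S\<^sub>m\<^sub>-\<^sub>2\<close> (\<open>summand_rec\<close>, \<open>double_sum_rec\<close>). The initial values agree.
\<close>

section \<open>Generating functions of weighted sets\<close>

definition gf :: "('a \<Rightarrow> nat) \<Rightarrow> 'a set \<Rightarrow> rat fps" where
  "gf w A = Abs_fps (\<lambda>m. of_nat (card {x \<in> A. w x = m}))"

lemma gf_Un_Int:
  assumes "\<And>m. finite {x \<in> A. w x = m}" "\<And>m. finite {x \<in> B. w x = m}"
  shows "gf w (A \<union> B) + gf w (A \<inter> B) = gf w A + gf w B"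
proof (rule fps_ext)
  fix m
  let ?A = "{x \<in> A. w x = m}" and ?B = "{x \<in> B. w x = m}"
  have "card {x \<in> A \<union> B. w x = m} + card {x \<in> A \<inter> B. w x = m} = card (?A \<union> ?B) + card (?A \<inter> ?B)"
    by (intro arg_cong2[where f = "(+)"] arg_cong[where f = card]) auto
  also have "\<dots> = card ?A + card ?B"
    using card_Un_Int[OF assms(1)[of m] assms(2)[of m]] by simp
  finally show "fps_nth (gf w (A \<union> B) + gf w (A \<inter> B)) m = fps_nth (gf w A + gf w B) m"
    by (simp add: gf_def flip: of_nat_add)
qed

lemma gf_bij:
  assumes "bij_betw h A B" and w: "\<And>x. x \<in> A \<Longrightarrow> v (h x) = w x + c"
  shows "gf v B = fps_X ^ c * gf w A"
proof (rule fps_ext)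
  fix m
  have B: "B = h ` A" and inj: "inj_on h A"
    using assms(1) by (auto simp: bij_betw_def)
  have "card {y \<in> B. v y = m} = card (h ` {x \<in> A. w x + c = m})"
    by (rule arg_cong[where f = card]) (auto simp: B w)
  also have "\<dots> = card {x \<in> A. w x + c = m}"
    by (rule card_image) (rule inj_on_subset[OF inj], auto)
  also have "\<dots> = (if m < c then 0 else card {x \<in> A. w x = m - c})"
  proof (cases "m < c")
    case True
    then have "{x \<in> A. w x + c = m} = {}" by auto
    with True show ?thesis by simp
  next
    case False
    then have "{x \<in> A. w x + c = m} = {x \<in> A. w x = m - c}" by auto
    with False show ?thesis by simp
  qed
  finally show "fps_nth (gf v B) m = fps_nth (fps_X ^ c * gf w A) m"
    by (simp add: gf_def fps_X_power_mult_nth)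
qed

section \<open>P-partitions and removal of minimal elements\<close>

text \<open>The functions live on the whole type and vanish outside \<open>I\<close>. Prescribing the value 0 on a subset
  of \<open>I\<close> then amounts to deleting this subset from \<open>I\<close>, with no change of the function.\<close>

definition ppart :: "('a \<times> 'a) set \<Rightarrow> 'a set \<Rightarrow> ('a \<Rightarrow> nat) set" where
  "ppart R I = {f. (\<forall>(x, y) \<in> R. f y \<le> f x) \<and> (\<forall>x. x \<notin> I \<longrightarrow> f x = 0)}"

definition up_closed :: "('a \<times> 'a) set \<Rightarrow> 'a set \<Rightarrow> bool" where
  "up_closed R I \<longleftrightarrow> (\<forall>(x, y) \<in> R. y \<in> I \<longrightarrow> x \<in> I)"

text \<open>For up-closed \<open>I\<close> this is Stanley's numerator polynomial of the P-partition generating function;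
  multiplying by \<open>(q; q)\<close> of order \<open>card I\<close> clears the factors \<open>1 - q ^ card I\<close> that
  \<open>gf_ppart_split\<close> produces at each removal.\<close>

definition ppart_numerator :: "('a \<times> 'a) set \<Rightarrow> 'a set \<Rightarrow> rat fps" where
  "ppart_numerator R I = qpoch fps_X fps_X (card I) * gf (\<lambda>f. sum f I) (ppart R I)"

lemma finite_ppart_weight:
  assumes "finite I" "A \<subseteq> ppart R I"
  shows "finite {f \<in> A. sum f I = m}"
proof (rule finite_subset)
  show "finite {f. \<forall>x. (x \<in> I \<longrightarrow> f x \<in> {..m}) \<and> (x \<notin> I \<longrightarrow> f x = (0::nat))}"
    by (rule finite_set_of_finite_funs) (use assms in auto)
  show "{f \<in> A. sum f I = m} \<subseteq> {f. \<forall>x. (x \<in> I \<longrightarrow> f x \<in> {..m}) \<and> (x \<notin> I \<longrightarrow> f x = 0)}"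
    using assms member_le_sum[OF _ _ assms(1)] by (fastforce simp: ppart_def)
qed

lemma ppart_rtrancl:
  assumes "f \<in> ppart R I" "(x, y) \<in> R\<^sup>*"
  shows "f y \<le> f x"
  using assms(2,1) by (induction rule: rtrancl_induct) (auto simp: ppart_def intro: le_trans)

lemma gf_ppart_zero:
  assumes "finite I"
  shows "gf (\<lambda>f. sum f I) {f \<in> ppart R I. \<forall>x\<in>J. f x = 0} = gf (\<lambda>f. sum f (I - J)) (ppart R (I - J))"
proof -
  have "{f \<in> ppart R I. \<forall>x\<in>J. f x = 0} = ppart R (I - J)"
    by (auto simp: ppart_def)
  moreover have "sum f I = sum f (I - J)" if "f \<in> ppart R (I - J)" for f
    using assms that by (intro sum.mono_neutral_right) (auto simp: ppart_def)
  ultimately show ?thesis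
    using gf_bij[of id "ppart R (I - J)" _ "\<lambda>f. sum f I" "\<lambda>f. sum f (I - J)" 0] by simp
qed

text \<open>The P-partitions without the value 0 on \<open>I\<close> are those obtained by adding 1 everywhere on
  \<open>I\<close>, and this multiplies the generating function by \<open>q ^ card I\<close>. Up-closedness ensures that adding 1
  on \<open>I\<close> keeps the order: nothing outside \<open>I\<close> dominates an element of \<open>I\<close>.\<close>

lemma gf_ppart_split:
  assumes fin: "finite I" and up: "up_closed R I"
  shows "(1 - fps_X ^ card I) * gf (\<lambda>f. sum f I) (ppart R I)
       = gf (\<lambda>f. sum f I) {f \<in> ppart R I. \<exists>x\<in>I. f x = 0}"
proof -
  let ?w = "\<lambda>f. sum f I"
  let ?Z = "{f \<in> ppart R I. \<exists>x\<in>I. f x = 0}" and ?N = "{f \<in> ppart R I. \<forall>x\<in>I. f x \<noteq> 0}"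
  define h where "h = (\<lambda>(f::'a \<Rightarrow> nat) x. if x \<in> I then Suc (f x) else f x)"
  define h' where "h' = (\<lambda>(f::'a \<Rightarrow> nat) x. f x - 1)"
  have "bij_betw h (ppart R I) ?N"
  proof (rule bij_betw_byWitness[where f' = h'])
    show "\<forall>f\<in>ppart R I. h' (h f) = f" by (auto simp: h_def h'_def ppart_def fun_eq_iff)
    show "\<forall>f\<in>?N. h (h' f) = f" by (auto simp: h_def h'_def ppart_def fun_eq_iff)
    show "h ` ppart R I \<subseteq> ?N" using up by (auto simp: h_def ppart_def up_closed_def)
    show "h' ` ?N \<subseteq> ppart R I" by (fastforce simp: h'_def ppart_def intro: diff_le_mono)
  qed
  moreover have "?w (h f) = ?w f + card I" for f
    by (simp add: h_def sum.distrib[of _ "\<lambda>_. Suc 0", simplified])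
  ultimately have N: "gf ?w ?N = fps_X ^ card I * gf ?w (ppart R I)"
    by (intro gf_bij) auto
  have "gf ?w (?Z \<union> ?N) + gf ?w (?Z \<inter> ?N) = gf ?w ?Z + gf ?w ?N"
    by (rule gf_Un_Int; rule finite_ppart_weight[OF fin, where R = R]) auto
  moreover have "?Z \<union> ?N = ppart R I" "?Z \<inter> ?N = {}" by auto
  moreover have "gf ?w {} = 0" by (simp add: gf_def fps_eq_iff)
  ultimately have "gf ?w (ppart R I) = gf ?w ?Z + fps_X ^ card I * gf ?w (ppart R I)"
    unfolding N by (simp only: add_0_right)
  then show ?thesis unfolding left_diff_distrib mult_1_left by (simp only: diff_eq_eq)
qed

lemma qpoch_Suc: "qpoch a q (Suc n) = qpoch a q n * (1 - a * q ^ n)"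
  by (simp add: qpoch_def)

text \<open>If everything lies above \<open>z\<close>, the value 0 occurs iff it occurs at \<open>z\<close>. The new factor \<open>1 - q ^ card I\<close>
  of the normalisation is exactly the one absorbed by \<open>gf_ppart_split\<close>.\<close>

lemma ppart_numerator_one_min:
  assumes fin: "finite I" and up: "up_closed R I" and z: "z \<in> I"
    and min: "\<And>x. x \<in> I \<Longrightarrow> (x, z) \<in> R\<^sup>*"
  shows "ppart_numerator R I = ppart_numerator R (I - {z})"
proof -
  let ?w = "\<lambda>f. sum f I"
  have card: "card I = Suc (card (I - {z}))"
    using fin z by (metis card.remove)
  have "{f \<in> ppart R I. \<exists>x\<in>I. f x = 0} = {f \<in> ppart R I. \<forall>x\<in>{z}. f x = 0}"
    using z ppart_rtrancl[OF _ min] by fastforce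
  then have "(1 - fps_X ^ card I) * gf ?w (ppart R I)
      = gf (\<lambda>f. sum f (I - {z})) (ppart R (I - {z}))"
    using gf_ppart_split[OF fin up] gf_ppart_zero[OF fin, of R "{z}"] by simp
  then show ?thesis
    unfolding ppart_numerator_def card qpoch_Suc by (simp add: mult.assoc)
qed

text \<open>Here the value 0 occurs iff it occurs at \<open>y\<close> or at \<open>z\<close>, and the three terms come from
  inclusion-exclusion. The last one lacks two elements instead of one, so its normalisation is
  short of one more factor \<open>1 - q ^ (card I - 1)\<close>.\<close>

lemma ppart_numerator_two_min:
  assumes fin: "finite I" and up: "up_closed R I" and yz: "y \<in> I" "z \<in> I" "y \<noteq> z"
    and min: "\<And>x. x \<in> I \<Longrightarrow> (x, y) \<in> R\<^sup>* \<or> (x, z) \<in> R\<^sup>*"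
  shows "ppart_numerator R I = ppart_numerator R (I - {y}) + ppart_numerator R (I - {z})
       - (1 - fps_X ^ (card I - 1)) * ppart_numerator R (I - {y, z})"
proof -
  let ?w = "\<lambda>f. sum f I"
  let ?A = "\<lambda>J. {f \<in> ppart R I. \<forall>x\<in>J. f x = 0}"
  let ?g = "\<lambda>J. gf (\<lambda>f. sum f (I - J)) (ppart R (I - J))"
  define c where "c = card (I - {y, z})"
  have card: "card I = Suc (Suc c)" "card (I - {y}) = Suc c" "card (I - {z}) = Suc c"
  proof -
    have "I - {y} - {z} = I - {y, z}" "I - {z} - {y} = I - {y, z}" by auto
    moreover have "card (I - {y}) = Suc (card (I - {y} - {z}))"
      "card (I - {z}) = Suc (card (I - {z} - {y}))"
      by (rule card.remove; use fin yz in simp)+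
    ultimately show y: "card (I - {y}) = Suc c" and "card (I - {z}) = Suc c"
      by (simp_all only: c_def)
    show "card I = Suc (Suc c)" by (simp only: card.remove[OF fin yz(1)] y)
  qed
  have zero: "{f \<in> ppart R I. \<exists>x\<in>I. f x = 0} = ?A {y} \<union> ?A {z}"
  proof -
    have *: "f y = 0 \<or> f z = 0" if "f \<in> ppart R I" "x \<in> I" "f x = 0" for f x
      using min[OF that(2)] ppart_rtrancl[OF that(1), of x y] ppart_rtrancl[OF that(1), of x z]
        that(3) by auto
    have "(\<exists>x\<in>I. f x = 0) \<longleftrightarrow> f y = 0 \<or> f z = 0" if "f \<in> ppart R I" for f
    proof (intro iffI)
      assume "f y = 0 \<or> f z = 0"
      then show "\<exists>x\<in>I. f x = 0" using yz by auto
    next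
      assume "\<exists>x\<in>I. f x = 0"
      then obtain x where "x \<in> I" "f x = 0" by (elim bexE)
      with that show "f y = 0 \<or> f z = 0" by (rule *)
    qed
    then have "{f \<in> ppart R I. \<exists>x\<in>I. f x = 0} = {f \<in> ppart R I. f y = 0 \<or> f z = 0}"
      by (intro Collect_cong conj_cong) simp_all
    also have "\<dots> = ?A {y} \<union> ?A {z}" by auto
    finally show ?thesis .
  qed
  have "?A J \<subseteq> ppart R I" for J by auto
  note fin_fibre = finite_ppart_weight[OF fin this]
  have "gf ?w (?A {y} \<union> ?A {z}) + gf ?w (?A {y} \<inter> ?A {z}) = gf ?w (?A {y}) + gf ?w (?A {z})"
    by (rule gf_Un_Int[of "?A {y}" ?w "?A {z}"]) (rule fin_fibre)+
  moreover have "?A {y} \<inter> ?A {z} = ?A {y, z}" by auto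
  ultimately have "gf ?w (?A {y} \<union> ?A {z}) + ?g {y, z} = ?g {y} + ?g {z}"
    by (metis gf_ppart_zero[OF fin])
  then have union: "gf ?w (?A {y} \<union> ?A {z}) = ?g {y} + ?g {z} - ?g {y, z}"
    by (rule eq_diff_eq[THEN iffD2])
  have "(1 - fps_X ^ card I) * gf ?w (ppart R I) = ?g {y} + ?g {z} - ?g {y, z}"
    unfolding gf_ppart_split[OF fin up] zero by (rule union)
  then have rec: "(1 - fps_X * fps_X ^ Suc c) * gf ?w (ppart R I) = ?g {y} + ?g {z} - ?g {y, z}"
    unfolding card(1) by (simp only: power_Suc)
  have "ppart_numerator R I
      = qpoch fps_X fps_X (Suc c) * ((1 - fps_X * fps_X ^ Suc c) * gf ?w (ppart R I))"
    unfolding ppart_numerator_def card(1) qpoch_Suc[of _ _ "Suc c"] by (rule mult.assoc)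
  also have "\<dots> = qpoch fps_X fps_X (Suc c) * ?g {y} + qpoch fps_X fps_X (Suc c) * ?g {z}
      - (1 - fps_X ^ Suc c) * (qpoch fps_X fps_X c * ?g {y, z})"
    unfolding rec qpoch_Suc by (simp only: algebra_simps power_Suc)
  also have "\<dots> = ppart_numerator R (I - {y}) + ppart_numerator R (I - {z})
       - (1 - fps_X ^ (card I - 1)) * ppart_numerator R (I - {y, z})"
    unfolding ppart_numerator_def card c_def[symmetric] diff_Suc_1 ..
  finally show ?thesis .
qed

section \<open>The strip poset\<close>

text \<open>
  The pairs \<open>(x, y)\<close> with \<open>y\<close> covered by \<open>x\<close>. With the positions \<open>4i, 4i + 1, 4i + 2, 4i + 3\<close> standing for
  the parts of index \<open>i\<close> of \<open>a, b, d, c\<close>, this is the order that the interlacing conditions impose on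
  all the parts. The positions \<open>2m - 1\<close> and \<open>2m\<close> form the level \<open>m\<close> of the strip: the odd position is an
  entry of an inner partition (\<open>b\<close> or \<open>c\<close>), the even one of an outer partition (\<open>a\<close> or \<open>d\<close>). From
  \<open>m = 2\<close> on, the former has two upper neighbours and the latter one, all on level \<open>m - 1\<close>.
\<close>

definition strip :: "(nat \<times> nat) set" where
  "strip = {(x, y). even x \<and> y = x + 1 \<or> odd x \<and> (y = x + 2 \<or> y = x + 3)}"

lemma strip_odd_odd: "odd x \<Longrightarrow> (x, x + 2 * k) \<in> strip\<^sup>*"
proof (induction k)
  case (Suc k)
  then have "(x + 2 * k, x + 2 * Suc k) \<in> strip" by (auto simp: strip_def)
  with Suc show ?case by (meson rtrancl.rtrancl_into_rtrancl)
qed simp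

lemma strip_below_odd:
  assumes "x \<le> 2 * m + 1"
  shows "(x, 2 * m + 1) \<in> strip\<^sup>*"
proof (cases "odd x")
  case True
  then obtain i where "x = 2 * i + 1" by (elim oddE)
  with assms have "x + 2 * (m - i) = 2 * m + 1" by auto
  with strip_odd_odd[OF True, of "m - i"] show ?thesis by simp
next
  case False
  then obtain i where i: "x = 2 * i" by auto
  have "(x, x + 1) \<in> strip" using False by (auto simp: strip_def)
  moreover have "(x + 1, 2 * m + 1) \<in> strip\<^sup>*"
  proof -
    have "x + 1 + 2 * (m - i) = 2 * m + 1" using i assms by auto
    with strip_odd_odd[of "x + 1" "m - i"] False show ?thesis by simp
  qed
  ultimately show ?thesis by (meson converse_rtrancl_into_rtrancl)
qed

lemma strip_below_even:
  assumes "x \<le> 2 * m + 1"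
  shows "(x, 2 * m + 4) \<in> strip\<^sup>*"
proof -
  have "(2 * m + 1, 2 * m + 4) \<in> strip" by (auto simp: strip_def)
  with strip_below_odd[OF assms] show ?thesis by (meson rtrancl.rtrancl_into_rtrancl)
qed

definition strip_num :: "nat \<Rightarrow> rat fps" where
  "strip_num N = ppart_numerator strip {..<N}"

lemma up_closed_lessThan: "up_closed strip {..<N}"
  by (auto simp: up_closed_def strip_def)

lemma strip_num_0: "strip_num 0 = 1"
proof -
  have "ppart strip {} = {\<lambda>_. 0}" by (auto simp: ppart_def)
  then have "{f \<in> ppart strip {}. m = 0} = (if m = 0 then {\<lambda>_. 0} else {})" for m :: nat
    by auto
  then show ?thesis
    by (auto simp: strip_num_def ppart_numerator_def qpoch_def gf_def fps_eq_iff eq_commute[of 0])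
qed

lemma strip_num_1: "strip_num 1 = 1"
proof -
  have "strip_num 1 = ppart_numerator strip ({..<1} - {0})"
    unfolding strip_num_def
    by (rule ppart_numerator_one_min) (auto simp: up_closed_lessThan)
  also have "{..<1} - {0::nat} = {..<0}" by auto
  finally show ?thesis using strip_num_0 by (simp add: strip_num_def)
qed

lemma strip_num_even: "strip_num (2 * m + 2) = strip_num (2 * m + 1)"
proof -
  have "strip_num (2 * m + 2) = ppart_numerator strip ({..<2 * m + 2} - {2 * m + 1})"
    unfolding strip_num_def
  proof (rule ppart_numerator_one_min)
    show "(x, 2 * m + 1) \<in> strip\<^sup>*" if "x \<in> {..<2 * m + 2}" for x
      by (rule strip_below_odd) (use that in auto)
  qed (auto simp: up_closed_lessThan)
  also have "{..<2 * m + 2} - {2 * m + 1} = {..<2 * m + 1}" by auto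
  finally show ?thesis by (simp add: strip_num_def)
qed

lemma strip_reach_even:
  assumes "x < 2 * m \<or> x = 2 * m + 2"
  shows "(x, 2 * m + 2) \<in> strip\<^sup>*"
proof (cases "x = 2 * m + 2")
  case False
  with assms have "x \<le> 2 * (m - 1) + 1" "2 * (m - 1) + 4 = 2 * m + 2" by auto
  with strip_below_even[of x "m - 1"] show ?thesis by metis
qed auto

text \<open>The last two positions \<open>2m + 1\<close> and \<open>2m + 2\<close> are both minimal. Removing \<open>2m + 2\<close> leaves an initial
  segment, but removing \<open>2m + 1\<close> leaves \<open>Y\<close>, in which \<open>2m\<close> has become minimal beside \<open>2m + 2\<close>. A second
  application to \<open>Y\<close> leads to the set \<open>W\<close>, whose only minimal element is \<open>2m + 2\<close>, and thereby back to
  initial segments.\<close>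

lemma strip_num_odd:
  "strip_num (2 * m + 3) = (1 + fps_X ^ (2 * m + 2)) * strip_num (2 * m + 1)
     + fps_X ^ (2 * m + 1) * strip_num (2 * m)"
proof -
  let ?N = "ppart_numerator strip"
  let ?Y = "insert (2 * m + 2) {..<2 * m + 1}" and ?W = "insert (2 * m + 2) {..<2 * m}"
  have upY: "up_closed strip ?Y" and upW: "up_closed strip ?W"
    by (auto simp: up_closed_def strip_def)
  have "?N {..<2 * m + 3} = ?N ({..<2 * m + 3} - {2 * m + 1}) + ?N ({..<2 * m + 3} - {2 * m + 2})
      - (1 - fps_X ^ (card {..<2 * m + 3} - 1)) * ?N ({..<2 * m + 3} - {2 * m + 1, 2 * m + 2})"
  proof (rule ppart_numerator_two_min)
    fix x assume "x \<in> {..<2 * m + 3}"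
    then have "x \<le> 2 * m + 1 \<or> x = 2 * m + 2" by auto
    then show "(x, 2 * m + 1) \<in> strip\<^sup>* \<or> (x, 2 * m + 2) \<in> strip\<^sup>*"
      using strip_below_odd[of x m] by auto
  qed (auto simp: up_closed_lessThan)
  moreover have "{..<2 * m + 3} - {2 * m + 1} = ?Y" "{..<2 * m + 3} - {2 * m + 2} = {..<2 * m + 2}"
    "{..<2 * m + 3} - {2 * m + 1, 2 * m + 2} = {..<2 * m + 1}" by auto
  ultimately have X: "strip_num (2 * m + 3) = ?N ?Y + strip_num (2 * m + 2)
      - (1 - fps_X ^ (2 * m + 2)) * strip_num (2 * m + 1)"
    by (simp add: strip_num_def)
  have "?N ?Y = ?N (?Y - {2 * m + 2}) + ?N (?Y - {2 * m})
      - (1 - fps_X ^ (card ?Y - 1)) * ?N (?Y - {2 * m + 2, 2 * m})"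
  proof (rule ppart_numerator_two_min[OF _ upY])
    fix x assume "x \<in> ?Y"
    then have "x < 2 * m \<or> x = 2 * m + 2 \<or> x = 2 * m" by auto
    then show "(x, 2 * m + 2) \<in> strip\<^sup>* \<or> (x, 2 * m) \<in> strip\<^sup>*"
      using strip_reach_even[of x m] by auto
  qed auto
  moreover have "?Y - {2 * m + 2} = {..<2 * m + 1}" "?Y - {2 * m} = ?W"
    "?Y - {2 * m + 2, 2 * m} = {..<2 * m}" by auto
  ultimately have Y: "?N ?Y = strip_num (2 * m + 1) + ?N ?W
      - (1 - fps_X ^ (2 * m + 1)) * strip_num (2 * m)"
    by (simp add: strip_num_def)
  have "?N ?W = ?N (?W - {2 * m + 2})"
    by (rule ppart_numerator_one_min[OF _ upW]) (use strip_reach_even[of _ m] in auto)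
  moreover have "?W - {2 * m + 2} = {..<2 * m}" by auto
  ultimately have "?N ?W = strip_num (2 * m)" by (simp add: strip_num_def)
  then show ?thesis unfolding X Y strip_num_even by (simp add: algebra_simps)
qed

section \<open>Double shifted plane partitions as P-partitions of the strip\<close>

lemma support_subset_lessThan:
  fixes lam :: "nat \<Rightarrow> nat"
  assumes "\<forall>i\<ge>n. lam i = 0"
  shows "{i. lam i \<noteq> 0} \<subseteq> {..<n}"
proof
  fix i assume "i \<in> {i. lam i \<noteq> 0}"
  then have "\<not> n \<le> i" using assms by auto
  then show "i \<in> {..<n}" by simp
qed

lemma partition_vanish_iff:
  assumes "antimono lam" "finite {i. lam i \<noteq> (0::nat)}"
  shows "part_length lam \<le> n \<longleftrightarrow> (\<forall>i\<ge>n. lam i = 0)"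
proof
  assume le: "part_length lam \<le> n"
  show "\<forall>i\<ge>n. lam i = 0"
  proof (intro allI impI, rule ccontr)
    fix i assume "n \<le> i" "lam i \<noteq> 0"
    have "lam x \<noteq> 0" if "x \<le> i" for x
      using antimonoD[OF assms(1) that] \<open>lam i \<noteq> 0\<close> by auto
    then have "{..i} \<subseteq> {i. lam i \<noteq> 0}" by auto
    from card_mono[OF assms(2) this] le \<open>n \<le> i\<close> show False
      by (simp add: part_length_def)
  qed
next
  assume "\<forall>i\<ge>n. lam i = 0"
  from card_mono[OF _ support_subset_lessThan[OF this]] show "part_length lam \<le> n" by (simp add: part_length_def)
qed

lemma part_size_eq_sum:
  assumes "\<forall>i\<ge>n. lam i = 0"
  shows "part_size lam = (\<Sum>i<n. lam i)"
  unfolding part_size_def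
  by (rule sum.mono_neutral_left[OF _ support_subset_lessThan[OF assms]]) auto

lemma sum_lessThan_4:
  fixes f :: "nat \<Rightarrow> nat"
  shows "(\<Sum>i<4 * n. f i) = (\<Sum>i<n. f (4 * i) + f (4 * i + 1) + f (4 * i + 2) + f (4 * i + 3))"
proof (induction n)
  case (Suc n)
  have "4 * Suc n = Suc (Suc (Suc (Suc (4 * n))))" by simp
  then have "sum f {..<4 * Suc n} = sum f {..<4 * n} + f (4 * n) + f (Suc (4 * n))
      + f (Suc (Suc (4 * n))) + f (Suc (Suc (Suc (4 * n))))"
    by (simp only: sum.lessThan_Suc)
  then show ?case unfolding Suc sum.lessThan_Suc by (simp add: numeral_3_eq_3)
qed simp

text \<open>The last two residues are swapped because \<open>d\<close> precedes \<open>c\<close> in the strip: the first part of \<open>c\<close> is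
  below the first part of \<open>d\<close>.\<close>

definition split4 :: "(nat \<Rightarrow> nat) \<Rightarrow> dspp" where
  "split4 g = (\<lambda>i. g (4 * i), \<lambda>i. g (4 * i + 1), \<lambda>i. g (4 * i + 3), \<lambda>i. g (4 * i + 2))"

definition merge4 :: "dspp \<Rightarrow> nat \<Rightarrow> nat" where
  "merge4 = (\<lambda>(a, b, c, d) k. ([a, b, d, c] ! (k mod 4)) (k div 4))"

lemma all_mod_4:
  "(\<forall>k::nat. P k) \<longleftrightarrow> (\<forall>i. P (4 * i) \<and> P (4 * i + 1) \<and> P (4 * i + 2) \<and> P (4 * i + 3))"
proof (intro iffI allI)
  fix k :: nat
  assume *: "\<forall>i. P (4 * i) \<and> P (4 * i + 1) \<and> P (4 * i + 2) \<and> P (4 * i + 3)"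
  have "k = 4 * (k div 4) \<or> k = 4 * (k div 4) + 1 \<or> k = 4 * (k div 4) + 2 \<or> k = 4 * (k div 4) + 3"
    by presburger
  with *[rule_format, of "k div 4"] show "P k" by metis
qed blast

lemma merge4_nth:
  "merge4 (a, b, c, d) (4 * i) = a i" "merge4 (a, b, c, d) (4 * i + 1) = b i"
  "merge4 (a, b, c, d) (4 * i + 2) = d i" "merge4 (a, b, c, d) (4 * i + 3) = c i"
proof -
  have "(4 * i + 1) mod 4 = 1" "(4 * i + 1) div 4 = i" "(4 * i + 2) mod 4 = 2" "(4 * i + 2) div 4 = i"
    "(4 * i + 3) mod 4 = 3" "(4 * i + 3) div 4 = i"
    by presburger+
  note eqs = this
  show "merge4 (a, b, c, d) (4 * i) = a i" by (simp add: merge4_def)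
  show "merge4 (a, b, c, d) (4 * i + 1) = b i" unfolding merge4_def prod.case eqs by simp
  show "merge4 (a, b, c, d) (4 * i + 2) = d i" unfolding merge4_def prod.case eqs by simp
  show "merge4 (a, b, c, d) (4 * i + 3) = c i" unfolding merge4_def prod.case eqs by simp
qed

text \<open>Chaining two interlacing inequalities shows that each sequence decreases; a decreasing sequence
  has at most \<open>n\<close> nonzero entries iff it vanishes from index \<open>n\<close> on.\<close>

lemma DSPP001_iff:
  "(a, b, c, d) \<in> DSPP001 n \<longleftrightarrow>
     (\<forall>i. b i \<le> a i \<and> c i \<le> b i \<and> a (Suc i) \<le> b i \<and> c i \<le> d i
        \<and> b (Suc i) \<le> c i \<and> d (Suc i) \<le> c i)
     \<and> (\<forall>i\<ge>n. a i = 0 \<and> b i = 0 \<and> c i = 0 \<and> d i = 0)" (is "?L \<longleftrightarrow> ?I \<and> ?V")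
proof
  assume L: ?L
  then have "is_partition a" "is_partition b" "is_partition c" "is_partition d"
    by (auto simp: DSPP001_def is_dspp_def)
  with L show "?I \<and> ?V"
    by (auto simp: DSPP001_def is_dspp_def profile_step_def interlace_down_def interlace_up_def
        dspp_diag_length_def is_partition_def partition_vanish_iff)
next
  assume R: "?I \<and> ?V"
  then have le: "b i \<le> a i" "c i \<le> b i" "a (Suc i) \<le> b i" "c i \<le> d i" "b (Suc i) \<le> c i"
    "d (Suc i) \<le> c i" for i by blast+
  have "antimono a" "antimono b" "antimono c" "antimono d"
    by (rule decseq_SucI, rule le_trans, rule le, rule le)+
  moreover have "finite {i. l i \<noteq> 0}" if "\<forall>i\<ge>n. l i = 0" for l :: "nat \<Rightarrow> nat"
    by (rule finite_subset[OF support_subset_lessThan[OF that]]) simp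
  ultimately show ?L using R
    by (auto simp: DSPP001_def is_dspp_def profile_step_def interlace_down_def interlace_up_def
        dspp_diag_length_def is_partition_def partition_vanish_iff)
qed

lemma split4_in_DSPP001_iff: "split4 f \<in> DSPP001 n \<longleftrightarrow> f \<in> ppart strip {..<4 * n}"
proof -
  have par: "even (4 * i)" "odd (4 * i + 1)" "even (4 * i + 2)" "odd (4 * i + 3)" for i :: nat
    by simp_all
  have idx: "4 * i + 1 + 2 = 4 * i + 3" "4 * i + 1 + 3 = 4 * Suc i" "4 * i + 2 + 1 = 4 * i + 3"
    "4 * i + 3 + 2 = 4 * Suc i + 1" "4 * i + 3 + 3 = 4 * Suc i + 2" for i :: nat
    by simp_all
  have lt: "4 * i \<notin> {..<4 * n} \<longleftrightarrow> n \<le> i" "4 * i + 1 \<notin> {..<4 * n} \<longleftrightarrow> n \<le> i"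
    "4 * i + 2 \<notin> {..<4 * n} \<longleftrightarrow> n \<le> i" "4 * i + 3 \<notin> {..<4 * n} \<longleftrightarrow> n \<le> i" for i
    by auto
  have "(\<forall>(x, y) \<in> strip. f y \<le> f x) \<longleftrightarrow>
      (\<forall>x. (even x \<longrightarrow> f (x + 1) \<le> f x) \<and> (odd x \<longrightarrow> f (x + 2) \<le> f x \<and> f (x + 3) \<le> f x))"
    by (auto simp: strip_def)
  also have "\<dots> \<longleftrightarrow> (\<forall>i. f (4 * i + 1) \<le> f (4 * i)
        \<and> (f (4 * i + 3) \<le> f (4 * i + 1) \<and> f (4 * Suc i) \<le> f (4 * i + 1))
        \<and> f (4 * i + 3) \<le> f (4 * i + 2)
        \<and> (f (4 * Suc i + 1) \<le> f (4 * i + 3) \<and> f (4 * Suc i + 2) \<le> f (4 * i + 3)))"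
    by (subst all_mod_4) (simp only: par idx simp_thms)
  finally have ineq: "(\<forall>(x, y) \<in> strip. f y \<le> f x) \<longleftrightarrow> \<dots>" .
  have zero: "(\<forall>x. x \<notin> {..<4 * n} \<longrightarrow> f x = 0) \<longleftrightarrow>
      (\<forall>i\<ge>n. f (4 * i) = 0 \<and> f (4 * i + 1) = 0 \<and> f (4 * i + 3) = 0 \<and> f (4 * i + 2) = 0)"
    by (subst all_mod_4) (unfold lt, blast)
  show ?thesis
    unfolding ppart_def mem_Collect_eq ineq zero split4_def DSPP001_iff by blast
qed

lemma bij_betw_split4: "bij_betw split4 (ppart strip {..<4 * n}) (DSPP001 n)"
proof (rule bij_betw_byWitness[where f' = merge4])
  show inv: "\<forall>L\<in>DSPP001 n. split4 (merge4 L) = L"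
    by (clarify) (simp only: split4_def merge4_nth)
  show "\<forall>g\<in>ppart strip {..<4 * n}. merge4 (split4 g) = g"
    unfolding fun_eq_iff by (subst all_mod_4) (unfold split4_def merge4_nth, blast)
  show "split4 ` ppart strip {..<4 * n} \<subseteq> DSPP001 n"
    by (auto simp: split4_in_DSPP001_iff)
  show "merge4 ` DSPP001 n \<subseteq> ppart strip {..<4 * n}"
    using inv by (auto simp flip: split4_in_DSPP001_iff)
qed

lemma P001_eq_strip_num: "P001 n = strip_num (4 * n)"
proof -
  have "dspp_size (split4 g) = sum g {..<4 * n}" if g: "g \<in> ppart strip {..<4 * n}" for g
  proof -
    have "\<forall>i\<ge>n. g (4 * i + r) = 0" for r using g by (auto simp: ppart_def)
    note this[of 0] this[of 1] this[of 2] this[of 3]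
    then show ?thesis
      unfolding sum_lessThan_4
      by (simp add: dspp_size_def split4_def part_size_eq_sum[of n] sum.distrib)
  qed
  then have "gf dspp_size (DSPP001 n) = gf (\<lambda>g. sum g {..<4 * n}) (ppart strip {..<4 * n})"
    using gf_bij[OF bij_betw_split4, of n dspp_size _ 0] by simp
  then show ?thesis
    by (simp add: P001_def F001_def strip_num_def ppart_numerator_def gf_def)
qed

section \<open>The double sum\<close>

text \<open>A base without constant term makes the denominators of \<open>qbinom\<close> units, so that they can be
  cancelled.\<close>

lemma qpoch_unit:
  assumes "fps_nth q 0 = (0::rat)"
  shows "fps_nth (qpoch q q n) 0 \<noteq> 0"
  using assms by (induction n) (auto simp: qpoch_Suc qpoch_def)

lemma qbinom_eq_0: "n < m \<or> m < 0 \<Longrightarrow> qbinom q n m = 0"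
  by (auto simp: qbinom_def)

lemma qbinom_0 [simp]: "fps_nth q 0 = 0 \<Longrightarrow> n \<ge> 0 \<Longrightarrow> qbinom q n 0 = 1"
  using qpoch_unit[of q]
  by (simp add: qbinom_def qpoch_def[of _ _ 0] fps_divide_unit inverse_mult_eq_1')

lemma qbinom_self [simp]: "fps_nth q 0 = 0 \<Longrightarrow> n \<ge> 0 \<Longrightarrow> qbinom q n n = 1"
  using qpoch_unit[of q]
  by (simp add: qbinom_def qpoch_def[of _ _ 0] fps_divide_unit inverse_mult_eq_1')

lemma qbinom_nat:
  assumes "fps_nth q 0 = 0"
  shows "qbinom q (int (m + l)) (int m) * (qpoch q q m * qpoch q q l) = qpoch q q (m + l)"
  using qpoch_unit[OF assms]
  by (simp add: qbinom_def nat_add_distrib fps_divide_unit mult.assoc inverse_mult_eq_1)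

text \<open>Over the common denominator the two rules read
  \<open>1 - q ^ (m + l + 2) = (1 - q ^ (l + 1)) + q ^ (l + 1) * (1 - q ^ (m + 1))\<close> and
  \<open>1 - q ^ (m + l + 2) = q ^ (m + 1) * (1 - q ^ (l + 1)) + (1 - q ^ (m + 1))\<close>.\<close>

lemma qbinom_pascal_nat:
  assumes q: "fps_nth q 0 = 0"
  shows "qbinom q (int (m + l + 2)) (int m + 1)
      = qbinom q (int (m + l + 1)) (int m + 1) + q ^ (l + 1) * qbinom q (int (m + l + 1)) (int m)"
    and "qbinom q (int (m + l + 2)) (int m + 1)
      = q ^ (m + 1) * qbinom q (int (m + l + 1)) (int m + 1) + qbinom q (int (m + l + 1)) (int m)"
proof -
  let ?p = "qpoch q q"
  let ?d = "?p (Suc m) * ?p (Suc l)"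
  let ?A = "qbinom q (int (m + l + 2)) (int m + 1)"
  let ?B = "qbinom q (int (m + l + 1)) (int m + 1)"
  let ?C = "qbinom q (int (m + l + 1)) (int m)"
  have nz: "?d \<noteq> 0" using qpoch_unit[OF q] by (metis fps_zero_nth mult_eq_0_iff)
  have A: "?A * ?d = ?p (m + l + 1) * (1 - q ^ (m + l + 2))"
    using qbinom_nat[OF q, of "Suc m" "Suc l"] by (simp add: qpoch_Suc add_ac)
  have B: "?B * ?d = ?p (m + l + 1) * (1 - q ^ (l + 1))"
    using qbinom_nat[OF q, of "Suc m" l] by (simp add: qpoch_Suc[of _ _ l] mult_ac add_ac)
  have C: "?C * ?d = ?p (m + l + 1) * (1 - q ^ (m + 1))"
    using qbinom_nat[OF q, of m "Suc l"] by (simp add: qpoch_Suc[of _ _ m] mult_ac add_ac)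
  have "?A * ?d = (?B + q ^ (l + 1) * ?C) * ?d"
    unfolding distrib_right mult.assoc A B C by (simp add: algebra_simps power_add)
  then show "?A = ?B + q ^ (l + 1) * ?C" using nz by simp
  have "?A * ?d = (q ^ (m + 1) * ?B + ?C) * ?d"
    unfolding distrib_right mult.assoc A B C by (simp add: algebra_simps power_add)
  then show "?A = q ^ (m + 1) * ?B + ?C" using nz by simp
qed

text \<open>With zero outside the triangle the rules extend to all integer arguments except \<open>n = -1, m = 0\<close>,
  where the left side is 1 and the right side is 0; the second assumption keeps away from this
  corner.\<close>

lemma qbinom_pascal:
  assumes q: "fps_nth q 0 = 0" and "n \<ge> 0 \<or> m \<ge> 1"
  shows "qbinom q (n + 1) m = qbinom q n m + q ^ nat (n + 1 - m) * qbinom q n (m - 1)"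
    and "qbinom q (n + 1) m = q ^ nat m * qbinom q n m + qbinom q n (m - 1)"
proof -
  consider "m < 0" | "m > n + 1" | "m = 0" "n \<ge> 0" | "m = n + 1" "n \<ge> 0" | "0 < m" "m \<le> n"
    using assms(2) by linarith
  then have "qbinom q (n + 1) m = qbinom q n m + q ^ nat (n + 1 - m) * qbinom q n (m - 1)
     \<and> qbinom q (n + 1) m = q ^ nat m * qbinom q n m + qbinom q n (m - 1)"
  proof cases
    case 5
    define i l where "i = nat (m - 1)" and "l = nat (n - m)"
    with 5 have "n + 1 = int (i + l + 2)" "n = int (i + l + 1)" "m = int i + 1"
      "nat (n + 1 - m) = l + 1" "nat m = i + 1" "m - 1 = int i" by auto
    with qbinom_pascal_nat[OF q, of i l] show ?thesis by metis
  qed (use q in \<open>auto simp: qbinom_eq_0\<close>)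
  then show "qbinom q (n + 1) m = qbinom q n m + q ^ nat (n + 1 - m) * qbinom q n (m - 1)"
    and "qbinom q (n + 1) m = q ^ nat m * qbinom q n m + qbinom q n (m - 1)" by auto
qed

text \<open>The terms of the double sum with \<open>2n - 1\<close> generalised to \<open>m\<close>: the recurrence relates
  neighbouring \<open>m\<close> of both parities.\<close>

definition summand :: "nat \<Rightarrow> nat \<times> nat \<Rightarrow> rat fps" where
  "summand m = (\<lambda>(j, k). fps_X ^ (j^2 + k^2 + j)
            * qbinom (fps_X^2) (int m - int k) (int j)
            * qbinom (fps_X^2) (int j + 1) (int k))"

lemma summand_eq_0: "j + k > m \<Longrightarrow> summand m (j, k) = 0"
  by (simp add: summand_def qbinom_eq_0)

text \<open>The first q-Pascal rule is applied to the first binomial, the second one to the second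
  binomial; the exponents of \<open>q\<close> are arranged such that both resulting terms are again summands,
  with \<open>j + 1\<close> lowered to \<open>j\<close> and, in the last one, \<open>k\<close> lowered as well.\<close>

lemma summand_rec:
  "summand (m + 2) (j + 1, k) = summand (m + 1) (j + 1, k)
     + fps_X ^ (2 * m + 4) * summand (m + 1) (j, k)
     + (case k of 0 \<Rightarrow> 0 | Suc l \<Rightarrow> fps_X ^ (2 * m + 3) * summand m (j, l))"
proof (cases "j + k \<le> m + 1")
  case False
  then show ?thesis by (auto simp: summand_eq_0 split: nat.split)
next
  case True
  let ?X = "fps_X :: rat fps"
  let ?b = "qbinom (?X^2)"
  \<comment> \<open>the exponent of the base \<open>q\<^sup>2\<close> in the first q-Pascal rule\<close>
  define e where "e = m + 1 - k - j"
  have m: "m + 1 = e + j + k" using True by (simp add: e_def)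
  have X0: "fps_nth (?X^2) 0 = 0" by (simp add: power2_eq_square)
  have 1: "?b (int (m + 2) - int k) (int (j + 1)) = ?b (int (m + 1) - int k) (int (j + 1))
      + (?X^2) ^ e * ?b (int (m + 1) - int k) (int j)"
  proof -
    have "int (m + 2) - int k = int (m + 1) - int k + 1" "int j = int (j + 1) - 1"
      "e = nat (int (m + 1) - int k + 1 - int (j + 1))" using m by auto
    moreover have "int (m + 1) - int k \<ge> 0 \<or> int (j + 1) \<ge> 1" by simp
    ultimately show ?thesis using qbinom_pascal(1)[OF X0] by metis
  qed
  have 2: "?b (int (j + 1) + 1) (int k)
      = (?X^2) ^ k * ?b (int j + 1) (int k) + ?b (int j + 1) (int k - 1)"
    using qbinom_pascal(2)[OF X0, of "int j + 1" "int k"] by (simp add: algebra_simps)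
  have "summand (m + 2) (j + 1, k) = summand (m + 1) (j + 1, k)
      + ?X ^ ((j + 1)^2 + k^2 + (j + 1)) * ((?X^2) ^ e * ?b (int (m + 1) - int k) (int j))
        * ((?X^2) ^ k * ?b (int j + 1) (int k) + ?b (int j + 1) (int k - 1))"
    unfolding summand_def prod.case 1 2[symmetric] by (simp only: distrib_left distrib_right)
  also have "\<dots> = summand (m + 1) (j + 1, k) + fps_X ^ (2 * m + 4) * summand (m + 1) (j, k)
     + ?X ^ ((j + 1)^2 + k^2 + (j + 1) + 2 * e) * ?b (int (m + 1) - int k) (int j)
       * ?b (int j + 1) (int k - 1)"
  proof -
    have "(j + 1)^2 + k^2 + (j + 1) + 2 * e + 2 * k = (2 * m + 4) + (j^2 + k^2 + j)"
      using m by (simp add: power2_eq_square algebra_simps)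
    then have pow_main: "?X ^ ((j + 1)^2 + k^2 + (j + 1) + 2 * e) * (?X^2) ^ k
        = ?X ^ (2 * m + 4) * ?X ^ (j^2 + k^2 + j)"
      by (simp only: power_mult[symmetric] power_add[symmetric])
    have expand: "A * (E * B) * (K * C + D) = A * E * K * (B * C) + A * E * B * D"
      for A E B K C D :: "rat fps" by (simp add: algebra_simps)
    have pow_shifted: "?X ^ ((j + 1)^2 + k^2 + (j + 1)) * (?X^2) ^ e
        = ?X ^ ((j + 1)^2 + k^2 + (j + 1) + 2 * e)"
      by (simp only: power_mult[symmetric] power_add[symmetric])
    show ?thesis unfolding expand pow_main pow_shifted
      by (simp only: summand_def prod.case mult.assoc add.assoc)
  qed
  also have "?X ^ ((j + 1)^2 + k^2 + (j + 1) + 2 * e) * ?b (int (m + 1) - int k) (int j)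
       * ?b (int j + 1) (int k - 1)
     = (case k of 0 \<Rightarrow> 0 | Suc l \<Rightarrow> fps_X ^ (2 * m + 3) * summand m (j, l))"
  proof (cases k)
    case 0
    then show ?thesis by (simp add: qbinom_eq_0)
  next
    case (Suc l)
    have "(j + 1)^2 + k^2 + (j + 1) + 2 * e = (2 * m + 3) + (j^2 + l^2 + j)"
      using m Suc by (simp add: power2_eq_square algebra_simps)
    then have "?X ^ ((j + 1)^2 + k^2 + (j + 1) + 2 * e) = ?X ^ (2 * m + 3) * ?X ^ (j^2 + l^2 + j)"
      by (simp only: power_add)
    then show ?thesis using Suc by (simp add: summand_def mult_ac)
  qed
  finally show ?thesis .
qed

text \<open>For \<open>j = 0\<close> the second binomial restricts \<open>k\<close> to 0 and 1, and the first one is 1 on both sides.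
  This fails one step earlier: for \<open>k = 1\<close> the summand changes between \<open>m = 0\<close> and \<open>m = 1\<close>. Hence the
  recurrence starts at \<open>m + 2\<close>, and \<open>m = 0, 1\<close> are initial values.\<close>

lemma summand_0_rec: "summand (m + 2) (0, k) = summand (m + 1) (0, k)"
proof -
  have "fps_nth ((fps_X::rat fps)^2) 0 = 0" by (simp add: power2_eq_square)
  then show ?thesis
    by (cases "k \<le> 1") (auto simp: summand_def qbinom_eq_0)
qed

definition double_sum :: "nat \<Rightarrow> rat fps" where
  "double_sum m = sum (summand m) ({..m} \<times> {..m})"

text \<open>The range of summation may be enlarged at will, so index shifts need no care at the upper end.\<close>

lemma double_sum_box:
  assumes "m \<le> a" "m \<le> b"
  shows "double_sum m = (\<Sum>j\<le>a. \<Sum>k\<le>b. summand m (j, k))"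
proof -
  have "double_sum m = sum (summand m) ({..a} \<times> {..b})"
    unfolding double_sum_def
    by (rule sum.mono_neutral_left) (use assms in \<open>auto intro!: summand_eq_0\<close>)
  then show ?thesis by (simp add: sum.cartesian_product case_prod_unfold)
qed

lemma double_sum_rec:
  "double_sum (m + 2) = (1 + fps_X ^ (2 * m + 4)) * double_sum (m + 1)
     + fps_X ^ (2 * m + 3) * double_sum m"
proof -
  let ?B = "m + 1"
  have inner: "(\<Sum>k\<le>Suc ?B. case k of 0 \<Rightarrow> 0 | Suc l \<Rightarrow> fps_X ^ (2 * m + 3) * summand m (j, l))
      = fps_X ^ (2 * m + 3) * (\<Sum>k\<le>?B. summand m (j, k))" for j
    by (simp only: sum.atMost_Suc_shift nat.case add_0_left sum_distrib_left)
  have shift: "(\<Sum>j\<le>Suc ?B. \<Sum>k\<le>Suc ?B. summand M (j, k)) = (\<Sum>k\<le>Suc ?B. summand M (0, k))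
      + (\<Sum>j\<le>?B. \<Sum>k\<le>Suc ?B. summand M (j + 1, k))" for M
    by (subst sum.atMost_Suc_shift) (simp only: Suc_eq_plus1)
  have "double_sum (m + 2) = (\<Sum>j\<le>Suc ?B. \<Sum>k\<le>Suc ?B. summand (m + 2) (j, k))"
    by (rule double_sum_box) auto
  also have "\<dots> = (\<Sum>k\<le>Suc ?B. summand (m + 1) (0, k))
      + (\<Sum>j\<le>?B. \<Sum>k\<le>Suc ?B. summand (m + 1) (j + 1, k)
     + fps_X ^ (2 * m + 4) * summand (m + 1) (j, k)
     + (case k of 0 \<Rightarrow> 0 | Suc l \<Rightarrow> fps_X ^ (2 * m + 3) * summand m (j, l)))"
    by (simp only: shift summand_rec summand_0_rec)
  also have "\<dots> = (\<Sum>j\<le>Suc ?B. \<Sum>k\<le>Suc ?B. summand (m + 1) (j, k))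
      + fps_X ^ (2 * m + 4) * (\<Sum>j\<le>?B. \<Sum>k\<le>Suc ?B. summand (m + 1) (j, k))
      + fps_X ^ (2 * m + 3) * (\<Sum>j\<le>?B. \<Sum>k\<le>?B. summand m (j, k))"
    by (simp only: shift sum.distrib inner sum_distrib_left add.assoc)
  also have "(\<Sum>j\<le>Suc ?B. \<Sum>k\<le>Suc ?B. summand (m + 1) (j, k)) = double_sum (m + 1)"
    by (rule double_sum_box[symmetric]) auto
  also have "(\<Sum>j\<le>?B. \<Sum>k\<le>Suc ?B. summand (m + 1) (j, k)) = double_sum (m + 1)"
    by (rule double_sum_box[symmetric]) auto
  also have "(\<Sum>j\<le>?B. \<Sum>k\<le>?B. summand m (j, k)) = double_sum m"
    by (rule double_sum_box[symmetric]) auto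
  finally show ?thesis by (simp add: algebra_simps)
qed

lemma double_sum_0: "double_sum 0 = 1"
  by (simp add: double_sum_def summand_def power2_eq_square)

lemma double_sum_1: "double_sum 1 = 1 + fps_X + fps_X ^ 2"
proof -
  have "fps_nth ((fps_X::rat fps)^2) 0 = 0" by (simp add: power2_eq_square)
  then show ?thesis unfolding double_sum_box[OF order_refl order_refl]
    by (simp add: summand_def qbinom_eq_0 numeral_2_eq_2)
qed

lemma strip_num_eq_double_sum: "strip_num (2 * m + 1) = double_sum m"
proof (induction m rule: less_induct)
  case (less m)
  consider "m = 0" | "m = 1" | l where "m = l + 2"
    by (metis One_nat_def add_2_eq_Suc' not0_implies_Suc)
  then show ?case
  proof cases
    case 1
    then show ?thesis using strip_num_1 by (simp add: double_sum_0)
  next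
    case 2
    then show ?thesis
      using strip_num_odd[of 0] strip_num_1 double_sum_1 by (simp add: strip_num_0 numeral_3_eq_3 numeral_2_eq_2)
  next
    case 3
    have idx: "2 * (l + 2) + 1 = 2 * (l + 1) + 3" "2 * (l + 1) + 2 = 2 * l + 4" by simp_all
    have "2 * (l + 1) = 2 * l + 2" by simp
    then have "strip_num (2 * (l + 1)) = double_sum l"
      using strip_num_even[of l] less[of l] 3 by simp
    moreover have "strip_num (2 * (l + 1) + 1) = double_sum (l + 1)" using less[of "l + 1"] 3 by simp
    moreover have "2 * (l + 1) + 1 = 2 * l + 3" by simp
    ultimately show ?thesis
      unfolding 3 idx(1) strip_num_odd idx(2) double_sum_rec by (simp only:)
  qed
qed

theorem theorem5p5:
  fixes n :: nat
  assumes "n \<ge> 1"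
  shows "((\<lambda>(j, k). fps_X ^ (j^2 + k^2 + j)
            * qbinom (fps_X^2) (2 * int n - int k - 1) (int j)
            * qbinom (fps_X^2) (int j + 1) (int k))
          has_sum P001 n) (UNIV :: (nat \<times> nat) set)"
proof -
  \<comment> \<open>for \<open>n \<ge> 1\<close> the subtraction is exact\<close>
  define m where "m = 2 * n - 1"
  have m: "int m = 2 * int n - 1" "4 * n = 2 * m + 2" using assms by (auto simp: m_def)
  have "2 * int n - int k - 1 = int m - int k" for k using m(1) by simp
  then have fn: "(\<lambda>(j, k). fps_X ^ (j^2 + k^2 + j)
            * qbinom (fps_X^2) (2 * int n - int k - 1) (int j)
            * qbinom (fps_X^2) (int j + 1) (int k)) = summand m"
    by (simp only: summand_def)
  have "P001 n = double_sum m"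
    unfolding P001_eq_strip_num m(2) strip_num_even by (rule strip_num_eq_double_sum)
  moreover have "(summand m has_sum double_sum m) ({..m} \<times> {..m})"
    unfolding double_sum_def by (rule has_sum_finite) simp
  moreover have "summand m p = 0" if "p \<in> UNIV - {..m} \<times> {..m}" for p
    using that by (cases p) (auto intro!: summand_eq_0)
  ultimately show ?thesis
    unfolding fn using has_sum_cong_neutral[of UNIV "{..m} \<times> {..m}" "summand m" "summand m"] by auto
qed

end
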